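(* Let $\mathbb{F}$ be a field, $d\ge3$, $V$ a vector space over $\mathbb{F}$ of dimension $d+1$, and $\Phi=(A;\{E_i\}_{i=0}^d;A^*;\{E^*_i\}_{i=0}^d)$ a CH system on $V$ with eigenvalue sequence $\{\theta_i\}_{i=0}^d$, dual eigenvalue sequence $\{\theta^*_i\}_{i=0}^d$ and $\Phi$-split sequence $\{\phi_i\}_{i=1}^d$. Fix a nonzero vector $u^*\in E^*_0V$. The matrix representing $A$ with respect to the basis $\{E_iu^*\}_{i=0}^d$ of $V$ is $\mathrm{diag}(\theta_0,\theta_1,\ldots,\theta_d)$. The matrix representing $A^*$ with respect to $\{E_iu^*\}_{i=0}^d$ is circular Hessenberg, with $(i,i)$-entry $a^*_i$ $(0\le i\le d)$, $(i,i+1)$-entry $b^*_i$ $(0\le i\le d-1)$, $(i,i-1)$-entry $c^*_i$ $(1\le i\le d)$, $(0,d)$-entry $\xi^*$, and all other entries $0$, where $$\xi^*=\theta^*_0-a^*_0-b^*_0$$ and \begin{align*} c^*_i&=\frac{(\theta_i-\theta_d)(\theta_i-\theta_{d-1})\cdots(\theta_i-\theta_{i+1})}{(\theta_{i-1}-\theta_d)(\theta_{i-1}-\theta_{d-1})\cdots(\theta_{i-1}-\theta_i)}\,\phi_{d-i+1}\qquad(1\le i\le d),\\ a^*_0&=\theta^*_d+\frac{\phi_d}{\theta_0-\theta_1},\\ a^*_i&=\theta^*_{d-i}+\frac{\phi_{d-i}}{\theta_i-\theta_{i+1}}+\frac{\phi_{d-i+1}}{\theta_i-\theta_{i-1}}\qquad(1\le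 i\le d-1),\\ a^*_d&=\theta^*_0+\frac{\phi_1}{\theta_d-\theta_{d-1}},\\ b^*_0&=\frac{(\theta_0-\theta_d)(\theta_0-\theta_{d-1})\cdots(\theta_0-\theta_2)}{(\theta_1-\theta_d)(\theta_1-\theta_{d-1})\cdots(\theta_1-\theta_2)}\left(\theta^*_{d-1}-\theta^*_d+\frac{\phi_{d-1}}{\theta_0-\theta_2}+\frac{\phi_d}{\theta_1-\theta_0}\right),\\ b^*_i&=\frac{(\theta_i-\theta_d)(\theta_i-\theta_{d-1})\cdots(\theta_i-\theta_{i+2})}{(\theta_{i+1}-\theta_d)(\theta_{i+1}-\theta_{d-1})\cdots(\theta_{i+1}-\theta_{i+2})}\\ &\quad\times\left(\theta^*_{d-i-1}-\theta^*_{d-i}+\frac{\phi_{d-i-1}}{\theta_i-\theta_{i+2}}+\frac{\phi_{d-i}}{\theta_{i+1}-\theta_i}+\frac{\phi_{d-i+1}}{\theta_{i-1}-\theta_{i+1}}\right)\qquad(1\le i\le d-2),\\ b^*_{d-1}&=\theta^*_0-\theta^*_1+\frac{\phi_1}{\theta_d-\theta_{d-1}}+\frac{\phi_2}{\theta_{d-2}-\theta_d}. \end{align*}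
   Context: Rows and columns of $(d+1)\times(d+1)$ matrices are indexed by $0,\dots,d$. A matrix $M$ represents $B\in\mathrm{End}(V)$ with respect to a basis $\{w_i\}_{i=0}^d$ if $Bw_j=\sum_iM_{ij}w_i$. A matrix is circular Hessenberg if every entry below the subdiagonal is zero, every subdiagonal entry is nonzero, the $(0,d)$-entry is nonzero, and every other entry above the superdiagonal is zero. An element of $\mathrm{End}(V)$ is multiplicity-free if it is diagonalizable with all eigenspaces of dimension one. The primitive idempotent of a multiplicity-free $B$ for an eigenvalue $\theta$ is the $E\in\mathrm{End}(V)$ acting as the identity on the $\theta$-eigenspace and as $0$ on the other eigenspaces. A CH system on $V$ is a sequence $\Phi=(A;\{E_i\}_{i=0}^d;A^*;\{E^*_i\}_{i=0}^d)$ in $\mathrm{End}(V)$ such that: (i) $A,A^*$ are multiplicity-free; (ii) $\{E_i\}$ is an ordering of the primitive idempotents of $A$; (iii) $\{E^*_i\}$ is an ordering of the primitive idempotents of $A^*$; (iv) $E_iA^*E_j=0$ if $1<i-j$ or $1<j-i<d$, and $E_iA^*E_j\neq0$ if $i-j=1$ or $j-i=d$; (v) $E^*_iAE^*_j=0$ if $1<i-j$ or $1<j-i<d$, and $E^*_iAE^*_j\neq0$ if $i-j=1$ or $j-i=d$ $(0\le i,j\le d)$. $\theta_i$ (resp. $\theta^*_i$) is the eigenvalue of $A$ (resp. $A^*$) corresponding to $E_i$ (resp. $E^*_i$). It is known that there is a unique sequence $\{\phi_i\}_{i=1}^d$ of nonzero scalars (the $\Phi$-split sequence) such that for some basis of $V$,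 $A$ is represented by the lower bidiagonal matrix with $(i,i)$-entry $\theta_{d-i}$ and $(i,i-1)$-entry $1$, and $A^*$ by the upper bidiagonal matrix with $(i,i)$-entry $\theta^*_i$ and $(i-1,i)$-entry $\phi_i$ (all other entries $0$). It is known that $\{E_iu^*\}_{i=0}^d$ is a basis of $V$. Empty products equal $1$. *)

theory Defs
  imports Complex_Main "Jordan_Normal_Form.Matrix"
begin

text \<open>
  The ambient space \<open>V\<close> is the whole type \<open>'b\<close>, made into a vector space over the field \<open>'a\<close> by
  \<open>scale\<close>. Only the values of an indexed family at the indices \<open>0, \<dots>, d\<close> (for the split sequence
  \<open>1, \<dots>, d\<close>) matter.
\<close>

definition is_basis ::
    "('a::field \<Rightarrow> 'b::ab_group_add \<Rightarrow> 'b) \<Rightarrow>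
      nat \<Rightarrow> (nat \<Rightarrow> 'b) \<Rightarrow> bool" where
  "is_basis scale d w \<longleftrightarrow>
     inj_on w {0..d} \<and> \<not> module.dependent scale (w ` {0..d}) \<and>
     module.span scale (w ` {0..d}) = UNIV"

definition represents ::
    "('a::field \<Rightarrow> 'b::ab_group_add \<Rightarrow> 'b) \<Rightarrow>
      nat \<Rightarrow> (nat \<Rightarrow> 'b) \<Rightarrow> 'a mat \<Rightarrow> ('b \<Rightarrow> 'b) \<Rightarrow> bool" where
  "represents scale d w M B \<longleftrightarrow>
     is_basis scale d w \<and> M \<in> carrier_mat (d + 1) (d + 1) \<and>
     (\<forall>j\<le>d. B (w j) = (\<Sum>i = 0..d. scale (M $$ (i, j)) (w i)))"

definition eigenspace ::
    "('a::field \<Rightarrow> 'b::ab_group_add \<Rightarrow> 'b) \<Rightarrow>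
      ('b \<Rightarrow> 'b) \<Rightarrow> 'a \<Rightarrow> 'b set" where
  "eigenspace scale B \<theta> = {v. B v = scale \<theta> v}"

definition is_eigenvalue ::
    "('a::field \<Rightarrow> 'b::ab_group_add \<Rightarrow> 'b) \<Rightarrow>
      ('b \<Rightarrow> 'b) \<Rightarrow> 'a \<Rightarrow> bool" where
  "is_eigenvalue scale B \<theta> \<longleftrightarrow> (\<exists>v \<in> eigenspace scale B \<theta>. v \<noteq> 0)"

definition diagonalizable ::
    "('a::field \<Rightarrow> 'b::ab_group_add \<Rightarrow> 'b) \<Rightarrow>
      ('b \<Rightarrow> 'b) \<Rightarrow> bool" where
  "diagonalizable scale B \<longleftrightarrow>
     (\<exists>S. \<not> module.dependent scale S \<and> module.span scale S = UNIV \<and>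
       (\<forall>v\<in>S. \<exists>\<theta>. v \<in> eigenspace scale B \<theta>))"

definition multiplicity_free ::
    "('a::field \<Rightarrow> 'b::ab_group_add \<Rightarrow> 'b) \<Rightarrow>
      ('b \<Rightarrow> 'b) \<Rightarrow> bool" where
  "multiplicity_free scale B \<longleftrightarrow>
     Vector_Spaces.linear scale scale B \<and> diagonalizable scale B \<and>
     (\<forall>\<theta>. is_eigenvalue scale B \<theta> \<longrightarrow> vector_space.dim scale (eigenspace scale B \<theta>) = 1)"

definition primitive_idempotent ::
    "('a::field \<Rightarrow> 'b::ab_group_add \<Rightarrow> 'b) \<Rightarrow>
      ('b \<Rightarrow> 'b) \<Rightarrow> 'a \<Rightarrow> ('b \<Rightarrow> 'b) \<Rightarrow> bool" where
  "primitive_idempotent scale B \<theta> E \<longleftrightarrow>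
     is_eigenvalue scale B \<theta> \<and> Vector_Spaces.linear scale scale E \<and>
     (\<forall>v \<in> eigenspace scale B \<theta>. E v = v) \<and>
     (\<forall>\<eta>. is_eigenvalue scale B \<eta> \<and> \<eta> \<noteq> \<theta> \<longrightarrow> (\<forall>v \<in> eigenspace scale B \<eta>. E v = 0))"

definition idempotent_ordering ::
    "('a::field \<Rightarrow> 'b::ab_group_add \<Rightarrow> 'b) \<Rightarrow>
      nat \<Rightarrow> ('b \<Rightarrow> 'b) \<Rightarrow> (nat \<Rightarrow> 'b \<Rightarrow> 'b) \<Rightarrow> bool" where
  "idempotent_ordering scale d B E \<longleftrightarrow>
     bij_betw E {0..d} {P. \<exists>\<theta>. primitive_idempotent scale B \<theta> P}"

text \<open>The index conditions avoid truncated subtraction: \<open>j + 1 < i\<close> is \<open>1 < i - j\<close>, and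
  \<open>i + 1 < j \<and> j < i + d\<close> is \<open>1 < j - i < d\<close>.\<close>

definition circular_pattern ::
    "nat \<Rightarrow> (nat \<Rightarrow> 'b::zero \<Rightarrow> 'b) \<Rightarrow> ('b \<Rightarrow> 'b) \<Rightarrow> bool" where
  "circular_pattern d E B \<longleftrightarrow>
     (\<forall>i\<le>d. \<forall>j\<le>d.
        (j + 1 < i \<or> (i + 1 < j \<and> j < i + d) \<longrightarrow> E i \<circ> B \<circ> E j = (\<lambda>v. 0)) \<and>
        (i = j + 1 \<or> j = i + d \<longrightarrow> E i \<circ> B \<circ> E j \<noteq> (\<lambda>v. 0)))"

definition CH_system ::
    "('a::field \<Rightarrow> 'b::ab_group_add \<Rightarrow> 'b) \<Rightarrow>
      nat \<Rightarrow> ('b \<Rightarrow> 'b) \<Rightarrow> (nat \<Rightarrow> 'b \<Rightarrow> 'b) \<Rightarrow> ('b \<Rightarrow> 'b) \<Rightarrow> (nat \<Rightarrow> 'b \<Rightarrow> 'b) \<Rightarrow> bool" where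
  "CH_system scale d A E As Es \<longleftrightarrow>
     multiplicity_free scale A \<and> multiplicity_free scale As \<and>
     idempotent_ordering scale d A E \<and> idempotent_ordering scale d As Es \<and>
     circular_pattern d E As \<and> circular_pattern d Es A"

definition eigenvalue_sequence ::
    "('a::field \<Rightarrow> 'b::ab_group_add \<Rightarrow> 'b) \<Rightarrow>
      nat \<Rightarrow> ('b \<Rightarrow> 'b) \<Rightarrow> (nat \<Rightarrow> 'b \<Rightarrow> 'b) \<Rightarrow> (nat \<Rightarrow> 'a) \<Rightarrow> bool" where
  "eigenvalue_sequence scale d B E \<theta> \<longleftrightarrow> (\<forall>i\<le>d. primitive_idempotent scale B (\<theta> i) (E i))"

definition split_sequence ::
    "('a::field \<Rightarrow> 'b::ab_group_add \<Rightarrow> 'b) \<Rightarrow>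
      nat \<Rightarrow> ('b \<Rightarrow> 'b) \<Rightarrow> ('b \<Rightarrow> 'b) \<Rightarrow> (nat \<Rightarrow> 'a) \<Rightarrow> (nat \<Rightarrow> 'a) \<Rightarrow> (nat \<Rightarrow> 'a) \<Rightarrow> bool" where
  "split_sequence scale d A As \<theta> \<theta>s \<phi> \<longleftrightarrow>
     (\<forall>i\<in>{1..d}. \<phi> i \<noteq> 0) \<and>
     (\<exists>w. represents scale d w
            (mat (d + 1) (d + 1)
              (\<lambda>(i, j). if i = j then \<theta> (d - i) else if i = j + 1 then 1 else 0)) A \<and>
          represents scale d w
            (mat (d + 1) (d + 1)
              (\<lambda>(i, j). if i = j then \<theta>s i else if j = i + 1 then \<phi> j else 0)) As)"

definition circular_hessenberg :: "nat \<Rightarrow> 'a::field mat \<Rightarrow> bool" where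
  "circular_hessenberg d M \<longleftrightarrow>
     M \<in> carrier_mat (d + 1) (d + 1) \<and>
     (\<forall>i\<le>d. \<forall>j\<le>d.
        (j + 1 < i \<longrightarrow> M $$ (i, j) = 0) \<and>
        (i = j + 1 \<longrightarrow> M $$ (i, j) \<noteq> 0) \<and>
        (i + 1 < j \<and> (i, j) \<noteq> (0, d) \<longrightarrow> M $$ (i, j) = 0)) \<and>
     M $$ (0, d) \<noteq> 0"

definition c_star :: "nat \<Rightarrow> (nat \<Rightarrow> 'a::field) \<Rightarrow> (nat \<Rightarrow> 'a) \<Rightarrow> nat \<Rightarrow> 'a" where
  "c_star d \<theta> \<phi> i =
     (\<Prod>k\<in>{i+1..d}. \<theta> i - \<theta> k) / (\<Prod>k\<in>{i..d}. \<theta> (i - 1) - \<theta> k) * \<phi> (d - i + 1)"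

definition a_star ::
    "nat \<Rightarrow> (nat \<Rightarrow> 'a::field) \<Rightarrow> (nat \<Rightarrow> 'a) \<Rightarrow> (nat \<Rightarrow> 'a) \<Rightarrow> nat \<Rightarrow> 'a" where
  "a_star d \<theta> \<theta>s \<phi> i =
     (if i = 0 then \<theta>s d + \<phi> d / (\<theta> 0 - \<theta> 1)
      else if i = d then \<theta>s 0 + \<phi> 1 / (\<theta> d - \<theta> (d - 1))
      else \<theta>s (d - i) + \<phi> (d - i) / (\<theta> i - \<theta> (i + 1))
             + \<phi> (d - i + 1) / (\<theta> i - \<theta> (i - 1)))"

definition b_star ::
    "nat \<Rightarrow> (nat \<Rightarrow> 'a::field) \<Rightarrow> (nat \<Rightarrow> 'a) \<Rightarrow> (nat \<Rightarrow> 'a) \<Rightarrow> nat \<Rightarrow> 'a" where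
  "b_star d \<theta> \<theta>s \<phi> i =
     (if i = 0 then
        (\<Prod>k\<in>{2..d}. \<theta> 0 - \<theta> k) / (\<Prod>k\<in>{2..d}. \<theta> 1 - \<theta> k)
          * (\<theta>s (d - 1) - \<theta>s d + \<phi> (d - 1) / (\<theta> 0 - \<theta> 2) + \<phi> d / (\<theta> 1 - \<theta> 0))
      else if i = d - 1 then
        \<theta>s 0 - \<theta>s 1 + \<phi> 1 / (\<theta> d - \<theta> (d - 1)) + \<phi> 2 / (\<theta> (d - 2) - \<theta> d)
      else
        (\<Prod>k\<in>{i+2..d}. \<theta> i - \<theta> k) / (\<Prod>k\<in>{i+2..d}. \<theta> (i + 1) - \<theta> k)
          * (\<theta>s (d - i - 1) - \<theta>s (d - i) + \<phi> (d - i - 1) / (\<theta> i - \<theta> (i + 2))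
             + \<phi> (d - i) / (\<theta> (i + 1) - \<theta> i) + \<phi> (d - i + 1) / (\<theta> (i - 1) - \<theta> (i + 1))))"

definition xi_star ::
    "nat \<Rightarrow> (nat \<Rightarrow> 'a::field) \<Rightarrow> (nat \<Rightarrow> 'a) \<Rightarrow> (nat \<Rightarrow> 'a) \<Rightarrow> 'a" where
  "xi_star d \<theta> \<theta>s \<phi> = \<theta>s 0 - a_star d \<theta> \<theta>s \<phi> 0 - b_star d \<theta> \<theta>s \<phi> 0"

definition A_star_matrix ::
    "nat \<Rightarrow> (nat \<Rightarrow> 'a::field) \<Rightarrow> (nat \<Rightarrow> 'a) \<Rightarrow> (nat \<Rightarrow> 'a) \<Rightarrow> 'a mat" where
  "A_star_matrix d \<theta> \<theta>s \<phi> =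
     mat (d + 1) (d + 1) (\<lambda>(i, j).
       if i = j then a_star d \<theta> \<theta>s \<phi> i
       else if j = i + 1 then b_star d \<theta> \<theta>s \<phi> i
       else if i = j + 1 then c_star d \<theta> \<phi> i
       else if i = 0 \<and> j = d then xi_star d \<theta> \<theta>s \<phi>
       else 0)"

end

theory Submission
  imports Defs
begin

text \<open>
  Rescale the split basis so that its first vector is \<open>u\<^sup>*\<close>, giving \<open>y\<^sub>0 = u\<^sup>*, \<dots>, y\<^sub>d\<close>. The lower
  bidiagonal action of \<open>A\<close> yields \<open>E\<^sub>i y\<^sub>j = (\<theta>\<^sub>i - \<theta>\<^sub>d) \<cdots> (\<theta>\<^sub>i - \<theta>\<^bsub>d-j+1\<^esub>) E\<^sub>i u\<^sup>*\<close>, so the \<open>E\<^sub>i u\<^sup>*\<close> are nonzero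
  eigenvectors of \<open>A\<close> for distinct eigenvalues and form a basis. Let \<open>M\<close> represent \<open>A\<^sup>*\<close> in it; the
  circular pattern says which entries of \<open>M\<close> vanish. Applying \<open>E\<^sub>i\<close> to the upper bidiagonal action of
  \<open>A\<^sup>*\<close> on \<open>y\<^sub>j\<close> gives linear equations for row \<open>i\<close> of \<open>M\<close>, whose coefficient of \<open>M\<^sub>i\<^sub>k\<close> vanishes for
  \<open>k > d - j\<close>. Hence \<open>j = d - i + 1, d - i, d - i - 1\<close> successively determine the entries \<open>c\<^sup>*\<^sub>i\<close>, \<open>a\<^sup>*\<^sub>i\<close>, \<open>b\<^sup>*\<^sub>i\<close>,
  and \<open>i = j = 0\<close> determines \<open>\<xi>\<^sup>*\<close>.
\<close>

text \<open>The value at \<open>\<theta> i\<close> of the monic polynomial with roots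
  \<open>\<theta> n, ..., \<theta> d\<close>. The numerators and denominators in
  \<open>c_star\<close> and \<open>b_star\<close> are such values.\<close>

definition tail_prod :: "nat \<Rightarrow> (nat \<Rightarrow> 'a::field) \<Rightarrow> nat \<Rightarrow> nat \<Rightarrow> 'a" where
  "tail_prod d \<theta> i n = (\<Prod>k\<in>{n..d}. \<theta> i - \<theta> k)"

lemma tail_prod_rec:
  "n \<le> d \<Longrightarrow> tail_prod d \<theta> i n = (\<theta> i - \<theta> n) * tail_prod d \<theta> i (Suc n)"
  by (simp add: tail_prod_def prod.atLeast_Suc_atMost)

lemma tail_prod_empty [simp]: "d < n \<Longrightarrow> tail_prod d \<theta> i n = 1"
  by (simp add: tail_prod_def)

lemma tail_prod_eq_0 [simp]: "n \<le> i \<Longrightarrow> i \<le> d \<Longrightarrow> tail_prod d \<theta> i n = 0"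
  by (auto simp: tail_prod_def)

lemma tail_prod_nonzero:
  "inj_on \<theta> {0..d} \<Longrightarrow> i < n \<Longrightarrow> i \<le> d \<Longrightarrow> tail_prod d \<theta> i n \<noteq> 0"
  by (auto simp: tail_prod_def dest: inj_onD)

text \<open>The part of the argument that is pure field arithmetic. The corner entry
  \<open>M 0 d\<close> is exempt from \<open>zero\<close>, but its coefficient in \<open>row\<close>
  contains the factor \<open>\<theta> d - \<theta> d\<close> unless \<open>j = 0\<close>, so within
  row \<open>0\<close> it enters only that one equation.\<close>

lemma row_equations_solution:
  fixes M :: "nat \<Rightarrow> nat \<Rightarrow> 'a::field"
  assumes d: "2 \<le> d" and inj: "inj_on \<theta> {0..d}"
    and zero: "\<And>i j. i \<le> d \<Longrightarrow> j \<le> d \<Longrightarrow> j + 1 < i \<or> (i + 1 < j \<and> j < i + d) \<Longrightarrow> M i j = 0"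
    and row: "\<And>i j. i \<le> d \<Longrightarrow> j \<le> d \<Longrightarrow>
      (\<Sum>k = 0..d. M i k * tail_prod d \<theta> k (d + 1 - j)) =
      \<theta>s j * tail_prod d \<theta> i (d + 1 - j) +
      (if j = 0 then 0 else \<phi> j * tail_prod d \<theta> i (d + 2 - j))"
    and ij: "i \<le> d" "j \<le> d"
  shows "M i j = A_star_matrix d \<theta> \<theta>s \<phi> $$ (i, j)"
proof -
  note nz = tail_prod_nonzero[OF inj]
  have neq: "\<theta> i - \<theta> j \<noteq> 0" if "i \<noteq> j" "i \<le> d" "j \<le> d" for i j
    using inj that by (auto simp: inj_on_def)
  have c: "M i (i - 1) = c_star d \<theta> \<phi> i" if i: "1 \<le> i" "i \<le> d" for i
  proof -
    \<comment> \<open>For \<open>j = d + 1 - i\<close> the products start at \<open>i\<close>. They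
      vanish for \<open>k \<ge> i\<close>, which also removes the \<open>\<theta>s\<close> term, and
      \<open>zero\<close> covers \<open>k < i - 1\<close>.\<close>
    have "(\<Sum>k = 0..d. M i k * tail_prod d \<theta> k i) = (\<Sum>k\<in>{i - 1}. M i k * tail_prod d \<theta> k i)"
    proof (intro sum.mono_neutral_right ballI)
      fix k assume "k \<in> {0..d} - {i - 1}"
      then have "i \<le> k \<or> k + 1 < i" "k \<le> d" by auto
      then show "M i k * tail_prod d \<theta> k i = 0"
        using i by (auto simp: zero)
    qed (use i in auto)
    then have "M i (i - 1) * tail_prod d \<theta> (i - 1) i = \<phi> (d + 1 - i) * tail_prod d \<theta> i (Suc i)"
      using row[of i "d + 1 - i"] i by simp
    moreover have "tail_prod d \<theta> (i - 1) i \<noteq> 0"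
      using i by (intro nz) auto
    ultimately show ?thesis
      using i by (simp add: c_star_def tail_prod_def field_simps Suc_diff_le)
  qed
  have a: "M i i = a_star d \<theta> \<theta>s \<phi> i" if i: "i \<le> d" for i
  proof -
    \<comment> \<open>Here \<open>j = d - i\<close>. For \<open>i = 0\<close> the index
      \<open>i - 1\<close> truncates to \<open>0\<close> and would repeat the diagonal entry; for
      \<open>i = d\<close> one has \<open>j = 0\<close> and no \<open>\<phi>\<close> term.\<close>
    have eq: "(if i = 0 then 0 else M i (i - 1) * tail_prod d \<theta> (i - 1) (Suc i)) +
        M i i * tail_prod d \<theta> i (Suc i) =
      \<theta>s (d - i) * tail_prod d \<theta> i (Suc i) +
      (if i = d then 0 else \<phi> (d - i) * tail_prod d \<theta> i (Suc (Suc i)))"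
    proof -
      have "(\<Sum>k = 0..d. M i k * tail_prod d \<theta> k (Suc i)) =
          (\<Sum>k\<in>(if i = 0 then {i} else {i - 1, i}). M i k * tail_prod d \<theta> k (Suc i))"
      proof (intro sum.mono_neutral_right ballI)
        fix k assume "k \<in> {0..d} - (if i = 0 then {i} else {i - 1, i})"
        then have "Suc i \<le> k \<or> k + 1 < i" "k \<le> d" by (auto split: if_splits)
        then show "M i k * tail_prod d \<theta> k (Suc i) = 0"
          using i by (auto simp: zero)
      qed (use i in auto)
      then show ?thesis
        using row[of i "d - i"] i by (auto simp: Suc_diff_le split: if_splits)
    qed
    have T: "tail_prod d \<theta> i (Suc i) \<noteq> 0" "tail_prod d \<theta> i (Suc (Suc i)) \<noteq> 0"
      using i nz[of i "Suc i"] nz[of i "Suc (Suc i)"] by auto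
    \<comment> \<open>\<open>low\<close> inserts the value from \<open>c\<close>, and
      \<open>up\<close> splits off one factor; every term of \<open>eq\<close> becomes a multiple of
      the nonzero \<open>tail_prod d \<theta> i (Suc i)\<close>, which then cancels.\<close>
    have low: "i \<noteq> 0 \<Longrightarrow> M i (i - 1) * tail_prod d \<theta> (i - 1) (Suc i) =
        \<phi> (d - i + 1) / (\<theta> (i - 1) - \<theta> i) * tail_prod d \<theta> i (Suc i)"
    proof -
      assume "i \<noteq> 0"
      then have "tail_prod d \<theta> (i - 1) (Suc i) \<noteq> 0" "\<theta> (i - 1) - \<theta> i \<noteq> 0"
        using i nz[of "i - 1" "Suc i"] neq[of "i - 1" i] by auto
      moreover have "M i (i - 1) = tail_prod d \<theta> i (Suc i) /
          ((\<theta> (i - 1) - \<theta> i) * tail_prod d \<theta> (i - 1) (Suc i)) * \<phi> (d - i + 1)"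
        using c[of i] i \<open>i \<noteq> 0\<close> tail_prod_rec[of i d \<theta> "i - 1"]
        by (simp add: c_star_def tail_prod_def)
      ultimately show ?thesis by simp
    qed
    have up: "i \<noteq> d \<Longrightarrow> \<phi> (d - i) * tail_prod d \<theta> i (Suc (Suc i)) =
        \<phi> (d - i) / (\<theta> i - \<theta> (Suc i)) * tail_prod d \<theta> i (Suc i)"
      using i neq[of i "Suc i"] tail_prod_rec[of "Suc i" d \<theta> i] by simp
    have "M i i * tail_prod d \<theta> i (Suc i) =
      (\<theta>s (d - i) + (if i = d then 0 else \<phi> (d - i) / (\<theta> i - \<theta> (Suc i)))
        - (if i = 0 then 0 else \<phi> (d - i + 1) / (\<theta> (i - 1) - \<theta> i))) * tail_prod d \<theta> i (Suc i)"
      using eq low up by (auto simp: algebra_simps split: if_splits)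
    then have "M i i = \<theta>s (d - i) + (if i = d then 0 else \<phi> (d - i) / (\<theta> i - \<theta> (Suc i)))
        - (if i = 0 then 0 else \<phi> (d - i + 1) / (\<theta> (i - 1) - \<theta> i))"
      using T by simp
    \<comment> \<open>The value from \<open>c\<close> carries the denominator with the sign opposite
      to that in \<open>a_star\<close>.\<close>
    moreover have "- (\<phi> (d - i + 1) / (\<theta> (i - 1) - \<theta> i)) = \<phi> (d - i + 1) / (\<theta> i - \<theta> (i - 1))"
      by (metis minus_diff_eq minus_divide_right)
    ultimately show ?thesis
      using i d by (auto simp: a_star_def)
  qed
  have b: "M i (i + 1) = b_star d \<theta> \<theta>s \<phi> i" if i: "i < d" for i
  proof -
    \<comment> \<open>In the row equation for \<open>j = d - i - 1\<close>, \<open>T\<close> and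
      \<open>U\<close> are the coefficients of \<open>M i i\<close> and \<open>M i (i + 1)\<close>;
      \<open>T / U\<close> is the quotient of products in front of \<open>b_star\<close>.\<close>
    define T where "T = tail_prod d \<theta> i (i + 2)"
    define U where "U = tail_prod d \<theta> (i + 1) (i + 2)"
    have TU: "T \<noteq> 0" "U \<noteq> 0"
      using i nz[of i "i + 2"] nz[of "i + 1" "i + 2"] by (auto simp: T_def U_def)
    have eq: "(if i = 0 then 0 else M i (i - 1) * tail_prod d \<theta> (i - 1) (i + 2)) +
        M i i * T + M i (i + 1) * U =
      \<theta>s (d - i - 1) * T +
      (if i = d - 1 then 0 else \<phi> (d - i - 1) * tail_prod d \<theta> i (i + 3))"
    proof -
      have "(\<Sum>k = 0..d. M i k * tail_prod d \<theta> k (i + 2)) =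
          (\<Sum>k\<in>(if i = 0 then {i, i + 1} else {i - 1, i, i + 1}). M i k * tail_prod d \<theta> k (i + 2))"
      proof (intro sum.mono_neutral_right ballI)
        fix k assume "k \<in> {0..d} - (if i = 0 then {i, i + 1} else {i - 1, i, i + 1})"
        then have "i + 2 \<le> k \<or> k + 1 < i" "k \<le> d" by (auto split: if_splits)
        then show "M i k * tail_prod d \<theta> k (i + 2) = 0"
          using i by (auto simp: zero)
      qed (use i in auto)
      also have "\<dots> = (if i = 0 then 0 else M i (i - 1) * tail_prod d \<theta> (i - 1) (i + 2)) +
          M i i * T + M i (i + 1) * U"
      proof (cases "i = 0")
        case False
        then have "i - 1 \<noteq> i" "i - 1 \<noteq> i + 1" by auto
        then show ?thesis using False by (simp add: T_def U_def del: One_nat_def)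
      qed (simp add: T_def U_def)
      finally have "(\<Sum>k = 0..d. M i k * tail_prod d \<theta> k (i + 2)) = \<dots>" .
      moreover have "d + 1 - (d - i - 1) = i + 2" "d + 2 - (d - i - 1) = i + 3" "(d - i - 1 = 0) = (i = d - 1)"
        using i by auto
      ultimately show ?thesis
        using row[of i "d - i - 1"] i by (simp only: T_def)
    qed
    have low: "M i (i - 1) * tail_prod d \<theta> (i - 1) (i + 2) =
        \<phi> (d - i + 1) * (\<theta> i - \<theta> (i + 1)) / ((\<theta> (i - 1) - \<theta> i) * (\<theta> (i - 1) - \<theta> (i + 1))) * T"
      if "i \<noteq> 0"
    proof -
      have "tail_prod d \<theta> (i - 1) (i + 2) \<noteq> 0" "\<theta> (i - 1) - \<theta> i \<noteq> 0" "\<theta> (i - 1) - \<theta> (i + 1) \<noteq> 0"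
        using i that nz[of "i - 1" "i + 2"] neq[of "i - 1" i] neq[of "i - 1" "i + 1"] by auto
      moreover have "M i (i - 1) = (\<theta> i - \<theta> (i + 1)) * T /
          ((\<theta> (i - 1) - \<theta> i) * ((\<theta> (i - 1) - \<theta> (i + 1)) * tail_prod d \<theta> (i - 1) (i + 2))) * \<phi> (d - i + 1)"
        using c[of i] i that tail_prod_rec[of i d \<theta> "i - 1"] tail_prod_rec[of "i + 1" d \<theta> "i - 1"]
          tail_prod_rec[of "i + 1" d \<theta> i]
        by (simp add: c_star_def T_def flip: tail_prod_def)
      ultimately show ?thesis by simp
    qed
    have up: "\<phi> (d - i - 1) * tail_prod d \<theta> i (i + 3) = \<phi> (d - i - 1) / (\<theta> i - \<theta> (i + 2)) * T"
      if "i \<noteq> d - 1"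
      using i that neq[of i "i + 2"] tail_prod_rec[of "i + 2" d \<theta> i] by (simp add: T_def numeral_3_eq_3)
    \<comment> \<open>\<open>X\<close> and \<open>Y\<close> are what remains of the
      \<open>\<phi> (d - i - 1)\<close> term and of the subdiagonal term once \<open>T\<close> is
      taken out; each is \<open>0\<close> where its term is absent.\<close>
    define X where "X = (if i = d - 1 then 0 else \<phi> (d - i - 1) / (\<theta> i - \<theta> (i + 2)))"
    define Y where "Y = (if i = 0 then 0 else \<phi> (d - i + 1) * (\<theta> i - \<theta> (i + 1)) /
      ((\<theta> (i - 1) - \<theta> i) * (\<theta> (i - 1) - \<theta> (i + 1))))"
    have "M i (i + 1) * U = T * (\<theta>s (d - i - 1) + X - M i i - Y)"
      using eq low up unfolding X_def Y_def by (auto simp: algebra_simps split: if_splits)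
    then have M: "M i (i + 1) = T / U * (\<theta>s (d - i - 1) + X - M i i - Y)"
      using TU by (simp add: field_simps)
    \<comment> \<open>The \<open>\<phi> (d - i)\<close> term of \<open>a_star\<close> is given the
      denominator that \<open>b_star\<close> uses.\<close>
    have a': "M i i = \<theta>s (d - i) - \<phi> (d - i) / (\<theta> (i + 1) - \<theta> i)
        + (if i = 0 then 0 else \<phi> (d - i + 1) / (\<theta> i - \<theta> (i - 1)))"
    proof -
      have "- (\<phi> (d - i) / (\<theta> (i + 1) - \<theta> i)) = \<phi> (d - i) / (\<theta> i - \<theta> (i + 1))"
        by (metis minus_diff_eq minus_divide_right)
      then show ?thesis using a[of i] i by (auto simp: a_star_def)
    qed
    \<comment> \<open>Two terms contain \<open>\<phi> (d - i + 1)\<close>, one from the diagonal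
      entry and one from the subdiagonal entry. A partial fraction identity merges them into the
      single term of \<open>b_star\<close>.\<close>
    have Z: "- (if i = 0 then 0 else \<phi> (d - i + 1) / (\<theta> i - \<theta> (i - 1))) - Y =
        (if i = 0 then 0 else \<phi> (d - i + 1) / (\<theta> (i - 1) - \<theta> (i + 1)))"
    proof -
      have *: "- (p / (y - x)) - p * (y - z) / ((x - y) * (x - z)) = p / (x - z)"
        if "x - y \<noteq> 0" "x - z \<noteq> 0" for p x y z :: 'a
      proof -
        have "- (p / (y - x)) = p / (x - y)"
          by (metis minus_diff_eq minus_divide_right)
        then show ?thesis
          using that by (simp add: divide_simps) (simp add: algebra_simps)
      qed
      show ?thesis
        using *[of "\<theta> (i - 1)" "\<theta> i" "\<theta> (i + 1)"] neq[of "i - 1" i] neq[of "i - 1" "i + 1"] i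
        by (auto simp: Y_def)
    qed
    have "M i (i + 1) = T / U * (\<theta>s (d - i - 1) - \<theta>s (d - i) + X + \<phi> (d - i) / (\<theta> (i + 1) - \<theta> i)
       + (if i = 0 then 0 else \<phi> (d - i + 1) / (\<theta> (i - 1) - \<theta> (i + 1))))"
      unfolding M Z[symmetric] a' by (simp add: algebra_simps)
    \<comment> \<open>At \<open>i = d - 1\<close> both products are empty, and \<open>b_star\<close>
      omits the quotient.\<close>
    moreover have "T / U = 1" if "i = d - 1"
      using that i by (simp add: T_def U_def)
    moreover have "d - (d - 1) = 1" "d - Suc (d - Suc 0) = 0" "d - Suc (Suc (d - 2)) = 0"
      using d by auto
    ultimately show ?thesis
      using i d unfolding b_star_def T_def U_def tail_prod_def X_def
      by (auto simp: numeral_2_eq_2)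
  qed
  have xi: "M 0 d = xi_star d \<theta> \<theta>s \<phi>"
  proof -
    \<comment> \<open>For \<open>j = 0\<close> all tail products are empty, so the row equation says
      that row \<open>0\<close> of \<open>M\<close> sums to \<open>\<theta>s 0\<close>.\<close>
    have "(\<Sum>k = 0..d. M 0 k) = (\<Sum>k\<in>{0, 1, d}. M 0 k)"
      using d by (intro sum.mono_neutral_right) (auto simp: zero)
    then have "M 0 0 + M 0 1 + M 0 d = \<theta>s 0"
      using row[of 0 0] d by (simp add: add.assoc)
    then show ?thesis
      using a[of 0] b[of 0] d by (auto simp: xi_star_def algebra_simps)
  qed
  \<comment> \<open>\<open>d \<noteq> 1\<close> keeps the corner off the superdiagonal, which
    \<open>A_star_matrix\<close> tests first.\<close>
  consider "i = j" | "j = i + 1" | "i = j + 1" | "i = 0" "j = d" "d \<noteq> 1"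
    | "i \<noteq> j" "j + 1 < i \<or> (i + 1 < j \<and> j < i + d)"
    using ij by linarith
  then show ?thesis
    using ij d a b[of i] c[of i] xi zero[of i j] by cases (auto simp: A_star_matrix_def)
qed

section \<open>Primitive idempotents and eigenvector bases\<close>

context vector_space
begin

lemma is_basis_expansion:
  assumes "is_basis scale d v"
  obtains c where "x = (\<Sum>i = 0..d. scale (c i) (v i))"
proof -
  have "x \<in> span (v ` {0..d})" and "inj_on v {0..d}"
    using assms by (auto simp: is_basis_def)
  then obtain c where "x = (\<Sum>y\<in>v ` {0..d}. scale (c y) y)"
    by (auto simp: span_finite)
  then have "x = (\<Sum>i = 0..d. scale (c (v i)) (v i))"
    using \<open>inj_on v {0..d}\<close> by (simp add: sum.reindex)
  then show ?thesis by (rule that)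
qed

text \<open>On each vector of a spanning set of eigenvectors, both maps are the identity or zero
  according to the eigenvalue.\<close>

lemma primitive_idempotent_unique:
  assumes "diagonalizable scale B"
    and "primitive_idempotent scale B \<theta> P" "primitive_idempotent scale B \<theta> Q"
  shows "P = Q"
proof
  fix x
  obtain S where S: "independent S" "span S = UNIV" "\<forall>v\<in>S. \<exists>\<theta>. v \<in> eigenspace scale B \<theta>"
    using assms(1) by (auto simp: diagonalizable_def)
  interpret vector_space_pair scale scale ..
  have "P v = Q v" if v: "v \<in> S" for v
  proof -
    obtain \<eta> where \<eta>: "v \<in> eigenspace scale B \<eta>" using S v by auto
    then have "is_eigenvalue scale B \<eta>"
      using S(1) v dependent_zero[of S] unfolding is_eigenvalue_def by (intro bexI[of _ v]) auto
    then show ?thesis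
      using assms(2,3) \<eta> unfolding primitive_idempotent_def by (cases "\<eta> = \<theta>") auto
  qed
  then show "P x = Q x"
    using assms(2,3) S(2) linear_eq_on_span[of P Q S x] unfolding primitive_idempotent_def by blast
qed

text \<open>Equal eigenvalues would force equal idempotents, and \<open>E\<close> lists these
  without repetition.\<close>

lemma eigenvalue_sequence_inj:
  assumes "diagonalizable scale B" "inj_on E {0..d}" "eigenvalue_sequence scale d B E \<theta>"
  shows "inj_on \<theta> {0..d}"
proof (rule inj_onI)
  fix i j assume ij: "i \<in> {0..d}" "j \<in> {0..d}" "\<theta> i = \<theta> j"
  then have "E i = E j"
    using assms by (intro primitive_idempotent_unique[of B "\<theta> i"]) (auto simp: eigenvalue_sequence_def)
  then show "i = j" using assms(2) ij by (auto simp: inj_on_def)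
qed

lemma idempotent_eigenvector:
  assumes "eigenvalue_sequence scale d B E \<theta>" "inj_on \<theta> {0..d}" "i \<le> d" "j \<le> d"
    and "x \<in> eigenspace scale B (\<theta> i)"
  shows "E j x = (if j = i then x else 0)"
proof -
  have "is_eigenvalue scale B (\<theta> i)" "primitive_idempotent scale B (\<theta> j) (E j)"
    using assms by (auto simp: eigenvalue_sequence_def primitive_idempotent_def)
  moreover have "\<theta> i \<noteq> \<theta> j" if "j \<noteq> i"
    using inj_onD[OF assms(2), of i j] assms(3,4) that by auto
  ultimately show ?thesis
    using assms(5) unfolding primitive_idempotent_def by auto
qed

end

context finite_dimensional_vector_space
begin

text \<open>Applying \<open>E j\<close> to a vanishing combination isolates its \<open>j\<close>-th
  coefficient; \<open>d + 1\<close> independent vectors then span by dimension.\<close>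

lemma eigenvectors_basis:
  assumes dim: "dim (UNIV :: 'b set) = d + 1"
    and E: "eigenvalue_sequence scale d B E \<theta>" and inj: "inj_on \<theta> {0..d}"
    and v: "\<And>i. i \<le> d \<Longrightarrow> v i \<in> eigenspace scale B (\<theta> i)" "\<And>i. i \<le> d \<Longrightarrow> v i \<noteq> 0"
  shows "is_basis scale d v"
proof -
  have Ev: "E j (v i) = (if j = i then v i else 0)" if "i \<le> d" "j \<le> d" for i j
    using idempotent_eigenvector[OF E inj that] v that by auto
  have v_inj: "inj_on v {0..d}"
  proof (rule inj_onI)
    fix i j assume "i \<in> {0..d}" "j \<in> {0..d}" "v i = v j"
    then show "i = j" using Ev[of i i] Ev[of j i] v(2)[of i] by (auto split: if_splits)
  qed
  have "independent (v ` {0..d})"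
  proof (rule independent_if_scalars_zero)
    fix f x assume 0: "(\<Sum>x\<in>v ` {0..d}. scale (f x) x) = 0" and "x \<in> v ` {0..d}"
    then obtain j where j: "j \<le> d" "x = v j" by auto
    interpret Ej: Vector_Spaces.linear scale scale "E j"
      using E j by (auto simp: eigenvalue_sequence_def primitive_idempotent_def)
    have "(\<Sum>i = 0..d. scale (f (v i)) (v i)) = 0"
      using 0 v_inj by (simp add: sum.reindex)
    then have "0 = E j (\<Sum>i = 0..d. scale (f (v i)) (v i))"
      by (simp add: Ej.zero)
    also have "\<dots> = (\<Sum>i = 0..d. if j = i then scale (f (v i)) (v i) else 0)"
      unfolding Ej.sum Ej.scale using j by (intro sum.cong) (auto simp: Ev)
    also have "\<dots> = scale (f (v j)) (v j)"
      using j by simp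
    finally show "f x = 0"
      using v(2)[of j] j by (simp add: eq_commute[of 0])
  qed simp
  moreover from this have "UNIV \<subseteq> span (v ` {0..d})"
    using v_inj by (intro card_ge_dim_independent) (auto simp: dim card_image simp del: dim_UNIV)
  ultimately show ?thesis
    using v_inj by (auto simp: is_basis_def)
qed

text \<open>In the basis \<open>v\<close>, \<open>E j\<close> keeps only the \<open>j\<close>-th
  term. The eigenvectors are left free so that prescribed ones fit: \<open>w 0\<close> for
  \<open>Es\<close>, and the vectors \<open>E i us\<close> for \<open>E\<close>.\<close>

lemma idempotent_range:
  assumes dim: "dim (UNIV :: 'b set) = d + 1"
    and E: "eigenvalue_sequence scale d B E \<theta>" and inj: "inj_on \<theta> {0..d}"
    and v: "\<And>i. i \<le> d \<Longrightarrow> v i \<in> eigenspace scale B (\<theta> i)" "\<And>i. i \<le> d \<Longrightarrow> v i \<noteq> 0"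
    and j: "j \<le> d"
  obtains t where "E j x = scale t (v j)"
proof -
  have "is_basis scale d v"
    using eigenvectors_basis[OF assms(1-3)] v by blast
  then obtain c where x: "x = (\<Sum>i = 0..d. scale (c i) (v i))"
    by (rule is_basis_expansion)
  interpret Ej: Vector_Spaces.linear scale scale "E j"
    using E j by (auto simp: eigenvalue_sequence_def primitive_idempotent_def)
  have "E j x = (\<Sum>i = 0..d. if j = i then scale (c i) (v i) else 0)"
    unfolding x Ej.sum Ej.scale
    using idempotent_eigenvector[OF E inj _ j] v j by (intro sum.cong) auto
  also have "\<dots> = scale (c j) (v j)"
    using j by simp
  finally show ?thesis by (rule that)
qed

text \<open>The spectral decomposition: in a basis of eigenvectors of \<open>B\<close>, both
  \<open>B\<close> and all \<open>E j\<close> are diagonal.\<close>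

lemma idempotent_decomposition:
  assumes dim: "dim (UNIV :: 'b set) = d + 1"
    and E: "eigenvalue_sequence scale d B E \<theta>" and inj: "inj_on \<theta> {0..d}"
    and B: "Vector_Spaces.linear scale scale B"
  shows "x = (\<Sum>i = 0..d. E i x)"
    and "\<And>j. j \<le> d \<Longrightarrow> E j x \<in> eigenspace scale B (\<theta> j)"
    and "\<And>j. j \<le> d \<Longrightarrow> E j (B x) = scale (\<theta> j) (E j x)"
proof -
  interpret B: Vector_Spaces.linear scale scale B by (rule B)
  have "\<forall>i. \<exists>v. i \<le> d \<longrightarrow> v \<in> eigenspace scale B (\<theta> i) \<and> v \<noteq> 0"
    using E by (auto simp: eigenvalue_sequence_def primitive_idempotent_def is_eigenvalue_def)
  then obtain v where v: "\<And>i. i \<le> d \<Longrightarrow> v i \<in> eigenspace scale B (\<theta> i)"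
      "\<And>i. i \<le> d \<Longrightarrow> v i \<noteq> 0"
    by metis
  have "is_basis scale d v"
    using eigenvectors_basis[OF assms(1-3)] v by blast
  then obtain c where x: "x = (\<Sum>i = 0..d. scale (c i) (v i))"
    by (rule is_basis_expansion)
  have Bv: "B (v i) = scale (\<theta> i) (v i)" if "i \<le> d" for i
    using v(1)[OF that] by (simp add: eigenspace_def)
  have Ec: "E j (\<Sum>i = 0..d. scale (g i) (v i)) = scale (g j) (v j)" if j: "j \<le> d" for j g
  proof -
    interpret Ej: Vector_Spaces.linear scale scale "E j"
      using E j by (auto simp: eigenvalue_sequence_def primitive_idempotent_def)
    have "E j (\<Sum>i = 0..d. scale (g i) (v i)) = (\<Sum>i = 0..d. if j = i then scale (g i) (v i) else 0)"
      unfolding Ej.sum Ej.scale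
      using idempotent_eigenvector[OF E inj _ j] v j by (intro sum.cong) auto
    then show ?thesis using j by simp
  qed
  have Ex: "E j x = scale (c j) (v j)" if "j \<le> d" for j
    unfolding x by (rule Ec[OF that])
  show "x = (\<Sum>i = 0..d. E i x)"
    using Ex by (subst x) (auto intro!: sum.cong)
  show "E j x \<in> eigenspace scale B (\<theta> j)" if "j \<le> d" for j
    using that by (simp add: Ex eigenspace_def B.scale Bv mult.commute)
  have Bx: "B x = (\<Sum>i = 0..d. scale (c i * \<theta> i) (v i))"
    unfolding x B.sum B.scale by (intro sum.cong) (auto simp: Bv)
  show "E j (B x) = scale (\<theta> j) (E j x)" if "j \<le> d" for j
    unfolding Bx Ec[OF that] Ex[OF that] by (simp add: mult.commute)
qed

end

theorem proposition6p11:
  fixes scale :: "'a::field \<Rightarrow> 'b::ab_group_add \<Rightarrow> 'b"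
    and d :: nat
    and A As :: "'b \<Rightarrow> 'b"
    and E Es :: "nat \<Rightarrow> 'b \<Rightarrow> 'b"
    and \<theta> \<theta>s \<phi> :: "nat \<Rightarrow> 'a"
    and us :: 'b
  assumes "vector_space scale"
    and "d \<ge> 3"
    and "vector_space.dim scale (UNIV :: 'b set) = d + 1"
    and "CH_system scale d A E As Es"
    and "eigenvalue_sequence scale d A E \<theta>"
    and "eigenvalue_sequence scale d As Es \<theta>s"
    and "split_sequence scale d A As \<theta> \<theta>s \<phi>"
    and "us \<in> range (Es 0)"
    and "us \<noteq> 0"
  shows "represents scale d (\<lambda>i. E i us) (mat_diag (d + 1) \<theta>) A
    \<and> represents scale d (\<lambda>i. E i us) (A_star_matrix d \<theta> \<theta>s \<phi>) As
    \<and> circular_hessenberg d (A_star_matrix d \<theta> \<theta>s \<phi>)"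
proof -
  interpret vector_space scale by fact
  obtain w where
    wA: "represents scale d w (mat (d + 1) (d + 1)
      (\<lambda>(i, j). if i = j then \<theta> (d - i) else if i = j + 1 then 1 else 0)) A" and
    wAs: "represents scale d w (mat (d + 1) (d + 1)
      (\<lambda>(i, j). if i = j then \<theta>s i else if j = i + 1 then \<phi> j else 0)) As"
    using assms(7) by (auto simp: split_sequence_def)
  have w: "is_basis scale d w"
    using wA by (simp add: represents_def)
  \<comment> \<open>The split basis serves as the finite basis that the locale asks for.\<close>
  interpret finite_dimensional_vector_space scale "w ` {0..d}"
    using w by unfold_locales (auto simp: is_basis_def)
  interpret A: Vector_Spaces.linear scale scale A
    using assms(4) by (simp add: CH_system_def multiplicity_free_def)
  interpret As: Vector_Spaces.linear scale scale As
    using assms(4) by (simp add: CH_system_def multiplicity_free_def)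
  note dim = assms(3) and E = assms(5) and Es = assms(6)
  have inj: "inj_on \<theta> {0..d}" and injs: "inj_on \<theta>s {0..d}"
    using eigenvalue_sequence_inj[OF _ _ E] eigenvalue_sequence_inj[OF _ _ Es] assms(4)
    by (auto simp: CH_system_def multiplicity_free_def idempotent_ordering_def bij_betw_def)
  note decA = idempotent_decomposition[OF dim E inj A.linear_axioms]
  note decAs = idempotent_decomposition[OF dim Es injs As.linear_axioms]

  \<comment> \<open>Bidiagonal actions on the split basis\<close>
  have Aw: "A (w j) = scale (\<theta> (d - j)) (w j) + (if j = d then 0 else w (Suc j))" if j: "j \<le> d" for j
  proof -
    have "A (w j) = (\<Sum>i = 0..d. (if i = j then scale (\<theta> (d - j)) (w j) else 0) + (if i = Suc j then w (Suc j) else 0))"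
      using wA j unfolding represents_def by (auto intro!: sum.cong)
    then show ?thesis using j by (simp add: sum.distrib)
  qed
  have Asw: "As (w j) = scale (\<theta>s j) (w j) + (if j = 0 then 0 else scale (\<phi> j) (w (j - 1)))" if j: "j \<le> d" for j
  proof -
    have "As (w j) = (\<Sum>i = 0..d.
        scale (if i = j then \<theta>s i else if j = i + 1 then \<phi> j else 0) (w i))"
      using wAs j by (simp add: represents_def)
    \<comment> \<open>For \<open>j = 0\<close> the test \<open>i = j - 1\<close> truncates to
      \<open>i = 0\<close>, hence the inner guard.\<close>
    also have "\<dots> = (\<Sum>i = 0..d. (if i = j then scale (\<theta>s j) (w j) else 0) +
        (if i = j - 1 then if j = 0 then 0 else scale (\<phi> j) (w (j - 1)) else 0))"
      by (intro sum.cong) auto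
    finally show ?thesis using j less_imp_diff_less[of j "Suc d" 1]
      by (simp add: sum.distrib less_Suc_eq_le)
  qed

  \<comment> \<open>Rescaling the split basis to start at \<open>us\<close>\<close>
  have "w 0 \<noteq> 0"
    using w dependent_zero[of "w ` {0..d}"] by (force simp: is_basis_def)
  obtain z where z: "us = Es 0 z" using assms(8) by auto
  have "w 0 \<in> eigenspace scale As (\<theta>s 0)"
    using Asw[of 0] by (simp add: eigenspace_def)
  obtain c where us: "us = scale c (w 0)"
  proof -
    have "\<exists>f. \<forall>i\<le>d. f i \<in> eigenspace scale As (\<theta>s i) \<and> f i \<noteq> 0"
      using Es by (intro choice_iff'[THEN iffD1])
        (auto simp: eigenvalue_sequence_def primitive_idempotent_def is_eigenvalue_def)
    then obtain f where f: "\<And>i. i \<le> d \<Longrightarrow> f i \<in> eigenspace scale As (\<theta>s i)" "\<And>i. i \<le> d \<Longrightarrow> f i \<noteq> 0"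
      by blast
    \<comment> \<open>With \<open>w 0\<close> as the eigenvector for \<open>\<theta>s 0\<close>, the
      range of \<open>Es 0\<close> is the line through \<open>w 0\<close>.\<close>
    define g where "g = f(0 := w 0)"
    have g: "\<And>i. i \<le> d \<Longrightarrow> g i \<in> eigenspace scale As (\<theta>s i)" "\<And>i. i \<le> d \<Longrightarrow> g i \<noteq> 0"
      using f \<open>w 0 \<noteq> 0\<close> \<open>w 0 \<in> eigenspace scale As (\<theta>s 0)\<close> by (auto simp: g_def)
    obtain t where "Es 0 z = scale t (g 0)"
      using idempotent_range[OF dim Es injs g le0] by blast
    then show ?thesis using that[of t] z by (simp add: g_def)
  qed
  have "c \<noteq> 0" using us assms(9) by auto
  define y where "y j = scale c (w j)" for j
  define v where "v i = E i us" for i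
  have Ay: "A (y j) = scale (\<theta> (d - j)) (y j) + (if j = d then 0 else y (Suc j))" if "j \<le> d" for j
    using Aw[OF that] by (simp add: y_def A.scale scale_right_distrib mult.commute)
  have Asy: "As (y j) = scale (\<theta>s j) (y j) + (if j = 0 then 0 else scale (\<phi> j) (y (j - 1)))"
    if "j \<le> d" for j
    using Asw[OF that] by (simp add: y_def As.scale scale_right_distrib mult.commute)

  \<comment> \<open>The eigenvector basis \<open>v\<close>\<close>
  have linE: "Vector_Spaces.linear scale scale (E i)" if "i \<le> d" for i
    using E that by (auto simp: eigenvalue_sequence_def primitive_idempotent_def)
  \<comment> \<open>\<open>y (Suc j)\<close> is \<open>A - \<theta> (d - j)\<close> applied to
    \<open>y j\<close>, and \<open>E i\<close> turns \<open>A\<close> into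
    \<open>\<theta> i\<close>; each step thus adds the factor
    \<open>\<theta> i - \<theta> (d - j)\<close>.\<close>
  have Ey: "E i (y j) = scale (tail_prod d \<theta> i (d + 1 - j)) (v i)" if i: "i \<le> d" and j: "j \<le> d" for i j
    using j
  proof (induction j)
    case 0
    then show ?case by (simp add: y_def v_def us)
  next
    case (Suc j)
    interpret Ei: Vector_Spaces.linear scale scale "E i" by (rule linE[OF i])
    have "y (Suc j) = A (y j) - scale (\<theta> (d - j)) (y j)"
      using Ay[of j] Suc by simp
    then have "E i (y (Suc j)) = scale (\<theta> i - \<theta> (d - j)) (E i (y j))"
      by (simp add: Ei.diff Ei.scale decA(3)[OF i] scale_left_diff_distrib)
    then show ?case
      using Suc tail_prod_rec[of "d - j" d \<theta> i] by (simp add: Suc_diff_le)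
  qed
  \<comment> \<open>Otherwise \<open>Ey\<close> makes \<open>E i\<close> vanish on the whole split
    basis, although it fixes an eigenvector.\<close>
  have v0: "v i \<noteq> 0" if i: "i \<le> d" for i
  proof
    assume "v i = 0"
    interpret Ei: Vector_Spaces.linear scale scale "E i" by (rule linE[OF i])
    have Ew: "E i (w j) = 0" if "j \<le> d" for j
      using Ey[OF i that] \<open>v i = 0\<close> \<open>c \<noteq> 0\<close> by (simp add: y_def Ei.scale)
    have "E i x = 0" for x
    proof -
      obtain h where x: "x = (\<Sum>i = 0..d. scale (h i) (w i))"
        using w by (rule is_basis_expansion)
      show ?thesis unfolding x Ei.sum Ei.scale by (simp add: Ew)
    qed
    then show False
      using E i unfolding eigenvalue_sequence_def primitive_idempotent_def is_eigenvalue_def by metis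
  qed
  have vE: "v i \<in> eigenspace scale A (\<theta> i)" if "i \<le> d" for i
    unfolding v_def using that by (rule decA(2))
  have basis: "is_basis scale d v"
    using eigenvectors_basis[OF dim E inj vE v0] .
  have Ev: "E i (v j) = (if i = j then v j else 0)" if "i \<le> d" "j \<le> d" for i j
    using idempotent_eigenvector[OF E inj that(2,1) vE[OF that(2)]] .
  have Ecomb: "E i (\<Sum>k = 0..d. scale (h k) (v k)) = scale (h i) (v i)" if i: "i \<le> d" for i h
  proof -
    interpret Ei: Vector_Spaces.linear scale scale "E i" by (rule linE[OF i])
    have "E i (\<Sum>k = 0..d. scale (h k) (v k)) = (\<Sum>k = 0..d. if i = k then scale (h k) (v k) else 0)"
      unfolding Ei.sum Ei.scale using i by (intro sum.cong) (auto simp: Ev)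
    then show ?thesis using i by simp
  qed

  \<comment> \<open>The matrix of \<open>As\<close> in the basis \<open>v\<close>\<close>
  have "\<forall>j. \<exists>h. As (v j) = (\<Sum>i = 0..d. scale (h i) (v i))"
    using is_basis_expansion[OF basis] by metis
  then obtain N where "\<And>j. As (v j) = (\<Sum>i = 0..d. scale (N j i) (v i))"
    by metis
  then obtain M where M: "\<And>j. As (v j) = (\<Sum>i = 0..d. scale (M i j) (v i))"
    using that[of "\<lambda>i j. N j i"] by blast
  have EAs: "E i (As (v j)) = scale (M i j) (v i)" if "i \<le> d" for i j
    unfolding M using that by (rule Ecomb)

  have pattern: "circular_pattern d E As"
    using assms(4) by (simp add: CH_system_def)
  have zero: "M i j = 0" if "i \<le> d" "j \<le> d" "j + 1 < i \<or> (i + 1 < j \<and> j < i + d)" for i j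
  proof -
    have "E i \<circ> As \<circ> E j = (\<lambda>v. 0)"
      using pattern that unfolding circular_pattern_def by blast
    then have "E i (As (v j)) = 0"
      unfolding v_def by (metis comp_apply)
    then show ?thesis using EAs that v0 by simp
  qed
  \<comment> \<open>The range of \<open>E j\<close> lies on the line through \<open>v j\<close>, so
    \<open>M i j = 0\<close> would make the whole composition
    \<open>E i \<circ> As \<circ> E j\<close> vanish.\<close>
  have nonzero: "M i j \<noteq> 0" if ij: "i \<le> d" "j \<le> d" "i = j + 1 \<or> j = i + d" for i j
  proof
    assume "M i j = 0"
    interpret Ei: Vector_Spaces.linear scale scale "E i" by (rule linE) fact
    have "E i (As (E j x)) = 0" for x
    proof -
      obtain t where "E j x = scale t (v j)"
        using idempotent_range[OF dim E inj vE v0 ij(2)] by blast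
      then show ?thesis
        using EAs[OF ij(1)] \<open>M i j = 0\<close> by (simp add: As.scale Ei.scale)
    qed
    then have "E i \<circ> As \<circ> E j = (\<lambda>v. 0)" by auto
    then show False
      using pattern ij unfolding circular_pattern_def by blast
  qed
  \<comment> \<open>Both sides are the coefficient of \<open>v i\<close> in
    \<open>E i (As (y j))\<close>: the left one by expanding \<open>y j\<close> in \<open>v\<close>,
    the right one by \<open>Asy\<close>. For \<open>j \<ge> 1\<close>, \<open>d + 2 - j\<close> is
    \<open>d + 1 - (j - 1)\<close>, from \<open>y (j - 1)\<close>.\<close>
  have row: "(\<Sum>k = 0..d. M i k * tail_prod d \<theta> k (d + 1 - j)) =
      \<theta>s j * tail_prod d \<theta> i (d + 1 - j) +
      (if j = 0 then 0 else \<phi> j * tail_prod d \<theta> i (d + 2 - j))" if i: "i \<le> d" and j: "j \<le> d" for i j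
  proof -
    interpret Ei: Vector_Spaces.linear scale scale "E i" by (rule linE[OF i])
    have "y j = (\<Sum>k = 0..d. E k (y j))"
      by (rule decA(1))
    also have "\<dots> = (\<Sum>k = 0..d. scale (tail_prod d \<theta> k (d + 1 - j)) (v k))"
      using j by (intro sum.cong) (auto simp: Ey)
    finally have "E i (As (y j)) = (\<Sum>k = 0..d. scale (tail_prod d \<theta> k (d + 1 - j)) (E i (As (v k))))"
      by (simp add: As.sum As.scale Ei.sum Ei.scale)
    also have "\<dots> = scale (\<Sum>k = 0..d. M i k * tail_prod d \<theta> k (d + 1 - j)) (v i)"
      unfolding EAs[OF i] by (simp add: scale_sum_left mult.commute)
    finally have 1: "E i (As (y j)) = scale (\<Sum>k = 0..d. M i k * tail_prod d \<theta> k (d + 1 - j)) (v i)" .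
    have "E i (As (y j)) = scale (\<theta>s j * tail_prod d \<theta> i (d + 1 - j) +
      (if j = 0 then 0 else \<phi> j * tail_prod d \<theta> i (d + 2 - j))) (v i)"
      unfolding Asy[OF j] using j
      by (auto simp: Ei.add Ei.scale Ei.zero Ey[OF i] scale_left_distrib Suc_diff_le)
    with 1 v0[OF i] show ?thesis by simp
  qed
  have M_eq: "M i j = A_star_matrix d \<theta> \<theta>s \<phi> $$ (i, j)" if "i \<le> d" "j \<le> d" for i j
    by (rule row_equations_solution[OF _ inj zero row that]) (use assms(2) in auto)

  \<comment> \<open>The two representations and the circular Hessenberg shape\<close>
  have "represents scale d v (mat_diag (d + 1) \<theta>) A"
  proof -
    have "A (v j) = (\<Sum>i = 0..d. scale (mat_diag (d + 1) \<theta> $$ (i, j)) (v i))" if j: "j \<le> d" for j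
    proof -
      have "(\<Sum>i = 0..d. scale (mat_diag (d + 1) \<theta> $$ (i, j)) (v i)) =
          (\<Sum>i = 0..d. if i = j then scale (\<theta> i) (v i) else 0)"
        using j by (intro sum.cong) (auto simp: mat_diag_def)
      then show ?thesis
        using vE[OF j] j by (simp add: eigenspace_def)
    qed
    then show ?thesis
      using basis by (simp add: represents_def mat_diag_def)
  qed
  moreover have carrier: "A_star_matrix d \<theta> \<theta>s \<phi> \<in> carrier_mat (d + 1) (d + 1)"
    by (simp add: A_star_matrix_def)
  moreover have "represents scale d v (A_star_matrix d \<theta> \<theta>s \<phi>) As"
    using basis carrier unfolding represents_def by (auto simp: M M_eq intro!: sum.cong)
  moreover have "circular_hessenberg d (A_star_matrix d \<theta> \<theta>s \<phi>)"
    \<comment> \<open>The shape is read off from the circular pattern through \<open>M_eq\<close>,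
      not from the explicit formulas.\<close>
    unfolding circular_hessenberg_def
  proof (intro conjI allI impI carrier)
    show "A_star_matrix d \<theta> \<theta>s \<phi> $$ (0, d) \<noteq> 0"
      using nonzero[of 0 d] by (simp add: M_eq)
  next
    fix i j assume ij: "i \<le> d" "j \<le> d"
    show "A_star_matrix d \<theta> \<theta>s \<phi> $$ (i, j) = 0" if "j + 1 < i"
      using zero[of i j] ij that by (simp add: M_eq)
    show "A_star_matrix d \<theta> \<theta>s \<phi> $$ (i, j) \<noteq> 0" if "i = j + 1"
      using nonzero[of i j] ij that by (simp add: M_eq)
    show "A_star_matrix d \<theta> \<theta>s \<phi> $$ (i, j) = 0" if "i + 1 < j \<and> (i, j) \<noteq> (0, d)"
    proof -
      \<comment> \<open>In row \<open>0\<close> this holds because the corner is excluded, in the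
        other rows because \<open>j \<le> d\<close>.\<close>
      have "j < i + d" using that ij by (cases "i = 0") auto
      then show ?thesis using zero[of i j] ij that by (simp add: M_eq)
    qed
  qed
  ultimately show ?thesis
    by (simp add: v_def[abs_def])
qed

end
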